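(* Let $\mathbb{F}$ be a finite field, let $0\le\delta<n$ be integers, let $a_1,\dots,a_n\in\mathbb{F}$ be non-zero and pairwise different, and let $b\in\mathbb{F}$. For $\lambda=(\lambda_0,\dots,\lambda_\delta)\in\mathbb{P}^\delta$ let $s_\lambda(t)=\sum_{i=0}^\delta\lambda_it^i$ and let $\mathcal{C}_\lambda$ be the one-dimensional convolutional Goppa code of length $n$ generated by $$\mathcal{G}(z)=\big(s_\lambda(a_1z+b),\dots,s_\lambda(a_nz+b)\big),$$ so that $\{\mathcal{C}_\lambda\}_{\lambda\in\mathbb{P}^\delta}$ is the family of convolutional Goppa codes of type $[n,1,\delta]$ constructed on the points $p_i=a_iz+b$. Then the subset of $\mathbb{P}^\delta$ consisting of the points associated with MDS codes is a non-empty (Zariski) open subset. More precisely, $$\{\lambda\in\mathbb{P}^\delta\mid\mathcal{C}_\lambda\text{ is MDS}\}=\{\lambda\in\mathbb{P}^\delta\mid s_\lambda^{(j)}(b)\ne0\ \text{ for all }0\le j\le\delta\},$$ where $s^{(j)}_\lambda(t)=\sum_{r=j}^\delta\binom rj\lambda_rt^{r-j}$.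
   Context: $\mathbb{P}^\delta$ is the projective space over $\mathbb{F}$ of non-zero $(\lambda_0,\dots,\lambda_\delta)\in\mathbb{F}^{\delta+1}$ up to scaling. The codewords of $\mathcal{C}_\lambda$ are the vectors $\alpha(z)\mathcal{G}(z)\in\mathbb{F}[z]^n$ with $\alpha(z)\in\mathbb{F}[z]$. The weight of a polynomial vector is the total number of non-zero coefficients of its entries, and the free distance is the minimum weight of a non-zero codeword. The code $\mathcal{C}_\lambda$ of the family of type $[n,1,\delta]$ is called MDS if its free distance attains the generalized Singleton bound for one-dimensional codes of length $n$ and degree $\delta$, i.e. $d_{\mathrm{free}}(\mathcal{C}_\lambda)=n(\delta+1)$. *)

theory Defs
  imports
    "HOL-Computational_Algebra.Polynomial"
    "HOL-Library.Poly_Mapping"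
    "Jordan_Normal_Form.Matrix"
begin

section \<open>Projective space and its Zariski topology\<close>

definition scaling_rel :: "nat \<Rightarrow> ('a::field vec \<times> 'a vec) set" where
  "scaling_rel \<delta> = {(v, w). v \<in> carrier_vec (Suc \<delta>) - {0\<^sub>v (Suc \<delta>)} \<and>
                           (\<exists>c. c \<noteq> 0 \<and> w = c \<cdot>\<^sub>v v)}"

text \<open>A point is a whole equivalence class of homogeneous coordinate vectors.\<close>

definition proj_space :: "nat \<Rightarrow> 'a::field vec set set" where
  "proj_space \<delta> = (carrier_vec (Suc \<delta>) - {0\<^sub>v (Suc \<delta>)}) // scaling_rel \<delta>"

text \<open>A polynomial in the indeterminates \<open>x\<^sub>i\<close> is a finitely supported map from monomials to
  coefficients, a monomial being the finitely supported map from \<open>i\<close> to the exponent of \<open>x\<^sub>i\<close>.\<close>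

type_synonym 'a multipoly = "(nat \<Rightarrow>\<^sub>0 nat) \<Rightarrow>\<^sub>0 'a"

definition homogeneous_of_degree :: "nat \<Rightarrow> nat \<Rightarrow> 'a::zero multipoly \<Rightarrow> bool" where
  "homogeneous_of_degree \<delta> d f \<longleftrightarrow>
     (\<forall>m\<in>Poly_Mapping.keys f. Poly_Mapping.keys m \<subseteq> {0..\<delta>} \<and>
        (\<Sum>i\<in>Poly_Mapping.keys m. Poly_Mapping.lookup m i) = d)"

definition multipoly_eval :: "'a::comm_semiring_1 multipoly \<Rightarrow> 'a vec \<Rightarrow> 'a" where
  "multipoly_eval f v =
     (\<Sum>m\<in>Poly_Mapping.keys f. Poly_Mapping.lookup f m *
        (\<Prod>i\<in>Poly_Mapping.keys m. (v $ i) ^ Poly_Mapping.lookup m i))"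

definition proj_zero_set :: "nat \<Rightarrow> 'a::field multipoly set \<Rightarrow> 'a vec set set" where
  "proj_zero_set \<delta> S = {P \<in> proj_space \<delta>. \<forall>f\<in>S. \<forall>v\<in>P. multipoly_eval f v = 0}"

definition zariski_closed :: "nat \<Rightarrow> 'a::field vec set set \<Rightarrow> bool" where
  "zariski_closed \<delta> V \<longleftrightarrow>
     (\<exists>S. (\<forall>f\<in>S. \<exists>d. homogeneous_of_degree \<delta> d f) \<and> V = proj_zero_set \<delta> S)"

definition zariski_open :: "nat \<Rightarrow> 'a::field vec set set \<Rightarrow> bool" where
  "zariski_open \<delta> U \<longleftrightarrow> U \<subseteq> proj_space \<delta> \<and> zariski_closed \<delta> (proj_space \<delta> - U)"


section \<open>One-dimensional convolutional codes\<close>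

definition conv_code :: "'a::field poly vec \<Rightarrow> 'a poly vec set" where
  "conv_code G = range (\<lambda>\<alpha>. \<alpha> \<cdot>\<^sub>v G)"

definition weight :: "'a::zero poly vec \<Rightarrow> nat" where
  "weight w = (\<Sum>i<dim_vec w. card {k. Polynomial.coeff (w $ i) k \<noteq> 0})"

text \<open>On \<^typ>\<open>nat\<close>, \<^const>\<open>Inf\<close> of a non-empty set is its minimum.\<close>

definition free_distance :: "nat \<Rightarrow> 'a::field poly vec set \<Rightarrow> nat" where
  "free_distance n C = Inf (weight ` (C - {0\<^sub>v n}))"

text \<open>The right-hand side is the generalized Singleton bound
  \<open>(n - k) (\<lfloor>\<delta> / k\<rfloor> + 1) + \<delta> + 1\<close> for dimension \<open>k = 1\<close>.\<close>

definition is_MDS :: "nat \<Rightarrow> nat \<Rightarrow> 'a::field poly vec set \<Rightarrow> bool" where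
  "is_MDS n \<delta> C \<longleftrightarrow> free_distance n C = n * (\<delta> + 1)"


section \<open>The family of convolutional Goppa codes\<close>

definition s_poly :: "nat \<Rightarrow> 'a::field vec \<Rightarrow> 'a poly" where
  "s_poly \<delta> v = (\<Sum>i=0..\<delta>. Polynomial.monom (v $ i) i)"

definition s_hasse :: "nat \<Rightarrow> 'a::field vec \<Rightarrow> nat \<Rightarrow> 'a \<Rightarrow> 'a" where
  "s_hasse \<delta> v j t = (\<Sum>r=j..\<delta>. of_nat (r choose j) * v $ r * t ^ (r - j))"

definition goppa_generator ::
    "nat \<Rightarrow> nat \<Rightarrow> (nat \<Rightarrow> 'a::field) \<Rightarrow> 'a \<Rightarrow> 'a vec \<Rightarrow> 'a poly vec" where
  "goppa_generator n \<delta> a b v = vec n (\<lambda>i. s_poly \<delta> v \<circ>\<^sub>p [:b, a i:])"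

text \<open>All representatives of a point generate the same code (see \<open>goppa_code_class\<close> below);
  this common code is the code attached to the point.\<close>

definition goppa_code ::
    "nat \<Rightarrow> nat \<Rightarrow> (nat \<Rightarrow> 'a::field) \<Rightarrow> 'a \<Rightarrow> 'a vec set \<Rightarrow> 'a poly vec set" where
  "goppa_code n \<delta> a b P = the_elem ((\<lambda>v. conv_code (goppa_generator n \<delta> a b v)) ` P)"


section \<open>Independence of the representative\<close>

lemma proj_space_cases:
  assumes "P \<in> proj_space \<delta>" and "w \<in> P"
  shows "w \<in> carrier_vec (Suc \<delta>)" and "w \<noteq> 0\<^sub>v (Suc \<delta>)"
    and "P = {c \<cdot>\<^sub>v w |c. c \<noteq> 0}"
proof -
  obtain v where v: "v \<in> carrier_vec (Suc \<delta>)" "v \<noteq> 0\<^sub>v (Suc \<delta>)"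
    and P: "P = {c \<cdot>\<^sub>v v |c. c \<noteq> 0}"
    using assms(1) unfolding proj_space_def scaling_rel_def
    by (auto elim!: quotientE)
  from assms(2) P obtain d where d: "d \<noteq> 0" "w = d \<cdot>\<^sub>v v" by auto
  have vw: "v = inverse d \<cdot>\<^sub>v w"
    using d by (simp add: smult_smult_assoc)
  show "w \<in> carrier_vec (Suc \<delta>)" using d v by simp
  show "w \<noteq> 0\<^sub>v (Suc \<delta>)"
  proof
    assume "w = 0\<^sub>v (Suc \<delta>)"
    then have "v = 0\<^sub>v (Suc \<delta>)" by (subst vw) (auto intro!: eq_vecI)
    with v show False by simp
  qed
  show "P = {c \<cdot>\<^sub>v w |c. c \<noteq> 0}"
  proof (intro subset_antisym subsetI)
    fix x assume "x \<in> P"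
    then obtain c where "c \<noteq> 0" "x = c \<cdot>\<^sub>v v" using P by auto
    then have "x = (c * inverse d) \<cdot>\<^sub>v w"
      by (subst (asm) vw) (simp only: smult_smult_assoc)
    moreover have "c * inverse d \<noteq> 0" using \<open>c \<noteq> 0\<close> d(1) by simp
    ultimately show "x \<in> {c \<cdot>\<^sub>v w |c. c \<noteq> 0}" by blast
  next
    fix x assume "x \<in> {c \<cdot>\<^sub>v w |c. c \<noteq> 0}"
    then obtain c where "c \<noteq> 0" "x = c \<cdot>\<^sub>v w" by auto
    then have "x = (c * d) \<cdot>\<^sub>v v" "c * d \<noteq> 0"
      using d by (auto simp: smult_smult_assoc)
    then show "x \<in> P" using P by blast
  qed
qed

lemma proj_space_nonempty_class:
  assumes "P \<in> proj_space \<delta>"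
  shows "P \<noteq> {}"
proof -
  obtain v where v: "v \<in> carrier_vec (Suc \<delta>)" "v \<noteq> 0\<^sub>v (Suc \<delta>)"
    and P: "P = {w. \<exists>c. c \<noteq> 0 \<and> w = c \<cdot>\<^sub>v v}"
    using assms unfolding proj_space_def scaling_rel_def
    by (auto elim!: quotientE)
  have "1 \<cdot>\<^sub>v v \<in> P" unfolding P using one_neq_zero by blast
  then show ?thesis by blast
qed

lemma s_poly_smult:
  assumes "v \<in> carrier_vec (Suc \<delta>)"
  shows "s_poly \<delta> (c \<cdot>\<^sub>v v) = Polynomial.smult c (s_poly \<delta> v)"
  using assms
  by (intro poly_eqI) (auto simp: s_poly_def coeff_sum sum_distrib_left intro!: sum.cong)

lemma s_hasse_smult:
  assumes "v \<in> carrier_vec (Suc \<delta>)"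
  shows "s_hasse \<delta> (c \<cdot>\<^sub>v v) j t = c * s_hasse \<delta> v j t"
  using assms by (auto simp: s_hasse_def sum_distrib_left intro!: sum.cong)

lemma conv_code_goppa_generator_smult:
  assumes "v \<in> carrier_vec (Suc \<delta>)" and "c \<noteq> 0"
  shows "conv_code (goppa_generator n \<delta> a b (c \<cdot>\<^sub>v v)) = conv_code (goppa_generator n \<delta> a b v)"
proof -
  have G: "goppa_generator n \<delta> a b (c \<cdot>\<^sub>v v) = [:c:] \<cdot>\<^sub>v goppa_generator n \<delta> a b v"
    by (rule eq_vecI) (auto simp: goppa_generator_def s_poly_smult[OF assms(1)] pcompose_smult)
  have H: "[:inverse c:] \<cdot>\<^sub>v ([:c:] \<cdot>\<^sub>v H) = H" for H :: "'a poly vec"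
    using assms(2) by (simp add: smult_smult_assoc flip: one_pCons)
  show ?thesis
  proof (intro subset_antisym subsetI)
    fix x assume "x \<in> conv_code (goppa_generator n \<delta> a b (c \<cdot>\<^sub>v v))"
    then obtain \<alpha> where "x = \<alpha> \<cdot>\<^sub>v ([:c:] \<cdot>\<^sub>v goppa_generator n \<delta> a b v)"
      unfolding conv_code_def G by blast
    then have "x = (\<alpha> * [:c:]) \<cdot>\<^sub>v goppa_generator n \<delta> a b v"
      by (simp only: smult_smult_assoc)
    then show "x \<in> conv_code (goppa_generator n \<delta> a b v)"
      unfolding conv_code_def by blast
  next
    fix x assume "x \<in> conv_code (goppa_generator n \<delta> a b v)"
    then obtain \<alpha> where "x = \<alpha> \<cdot>\<^sub>v goppa_generator n \<delta> a b v"
      unfolding conv_code_def by blast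
    then have "x = (\<alpha> * [:inverse c:]) \<cdot>\<^sub>v ([:c:] \<cdot>\<^sub>v goppa_generator n \<delta> a b v)"
      by (simp only: H flip: smult_smult_assoc)
    then show "x \<in> conv_code (goppa_generator n \<delta> a b (c \<cdot>\<^sub>v v))"
      unfolding conv_code_def G by blast
  qed
qed

lemma goppa_code_class:
  assumes "P \<in> proj_space \<delta>" and "v \<in> P"
  shows "goppa_code n \<delta> a b P = conv_code (goppa_generator n \<delta> a b v)"
proof -
  have "(\<lambda>v. conv_code (goppa_generator n \<delta> a b v)) ` P
          = {conv_code (goppa_generator n \<delta> a b v)}"
    using proj_space_cases[OF assms] assms(2)
    by (auto simp: conv_code_goppa_generator_smult)
  then show ?thesis by (simp add: goppa_code_def)
qed

lemma s_hasse_class: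
  assumes "P \<in> proj_space \<delta>" and "v \<in> P" and "w \<in> P"
  shows "s_hasse \<delta> v j t = 0 \<longleftrightarrow> s_hasse \<delta> w j t = 0"
  using proj_space_cases[OF assms(1,2)] assms(3) by (auto simp: s_hasse_smult)

end

theory Submission
  imports Defs
begin

text \<open>
  Expanding \<open>s\<^sub>\<lambda>\<close> at \<open>b\<close> with Taylor coefficients \<open>h\<^sub>j = s\<^sub>\<lambda>\<^sup>(\<^sup>j\<^sup>)(b)\<close> turns the generator into
  \<open>(\<Sum>\<^sub>j h\<^sub>j a\<^sub>i\<^sup>j z\<^sup>j)\<^sub>i\<close>, whose weight is \<open>n\<close> times the number of non-zero \<open>h\<^sub>j\<close>; so an MDS code
  needs all of them. Conversely, the \<open>z\<^sup>m\<close>-coefficients of \<open>\<alpha>(z)\<G>(z)\<close> are the values at the \<open>a\<^sub>i\<close> of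
  \<open>q\<^sub>m(x) = \<Sum>\<^sub>j \<alpha>\<^sub>m\<^sub>-\<^sub>j h\<^sub>j x\<^sup>j\<close>, and a non-zero polynomial has at most as many non-zero roots as the
  difference between its largest and smallest exponent. If all \<open>h\<^sub>j\<close> are non-zero, the exponents of
  \<open>q\<^sub>m\<close> are read off from the part of the support of \<open>\<alpha>\<close> in the window \<open>{m - \<delta>..m}\<close>. Summed over \<open>m\<close>,
  these bounds give \<open>n (\<delta> + 1)\<close> for a monomial \<open>\<alpha>\<close>, and every gap \<open>g \<le> \<delta>\<close> between consecutive elements
  of the support adds \<open>n g - (\<delta> + 1 - g) g \<ge> 0\<close>, while a larger gap adds \<open>n (\<delta> + 1)\<close>.

  The MDS locus is thus the complement of the \<open>\<delta> + 1\<close> hyperplanes \<open>h\<^sub>j = 0\<close>, i.e. of the zero set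
  of the product of these linear forms, and it contains the point of \<open>\<Sum>\<^sub>j (t - b)\<^sup>j\<close>.
\<close>

section \<open>Supports seen through a sliding window\<close>

text \<open>Lower bound for the number of non-zero \<open>z\<^sup>m\<close>-coefficients of a codeword \<open>\<alpha>(z)\<G>(z)\<close>, where \<open>A\<close> is
  the support of \<open>\<alpha>\<close>.\<close>

definition row_bound :: "nat \<Rightarrow> nat \<Rightarrow> nat set \<Rightarrow> nat \<Rightarrow> int" where
  "row_bound n \<delta> A m =
     (let W = A \<inter> {k. k \<le> m \<and> m \<le> k + \<delta>}
      in if W = {} then 0 else int n - (int (Max W) - int (Min W)))"

lemma row_bound_singleton:
  "row_bound n \<delta> {q} m = (if q \<le> m \<and> m \<le> q + \<delta> then int n else 0)"
  by (auto simp: row_bound_def Let_def)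

text \<open>A row in \<open>{q..p + \<delta>}\<close> sees both \<open>p\<close> and
  \<open>q\<close>: the maximum of its window moves from \<open>p\<close> to \<open>q\<close>, the
  minimum stays, and it loses \<open>q - p\<close>. A row from \<open>q\<close> to
  \<open>q + \<delta>\<close> beyond \<open>p + \<delta>\<close> had an empty window, now sees
  \<open>q\<close> alone and gains \<open>n\<close>. Other rows do not change.\<close>

lemma row_bound_insert_max:
  assumes "finite A" and "A \<noteq> {}" and less: "\<forall>k\<in>A. k < q" and p: "p = Max A"
  shows "row_bound n \<delta> (insert q A) m \<ge> row_bound n \<delta> A m +
    ((if m \<in> {max q (Suc (p + \<delta>))..q + \<delta>} then int n else 0)
     - (if m \<in> {q..p + \<delta>} then int q - int p else 0))"
proof -
  define V where "V = A \<inter> {k. k \<le> m \<and> m \<le> k + \<delta>}"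
  define W where "W = insert q A \<inter> {k. k \<le> m \<and> m \<le> k + \<delta>}"
  have pA: "p \<in> A" "\<And>k. k \<in> A \<Longrightarrow> k \<le> p" using assms by auto
  have pq: "p < q" using less pA by auto
  have fin: "finite V" using assms(1) by (simp add: V_def)
  consider "m < q \<or> q + \<delta> < m" | "q \<le> m" "m \<le> p + \<delta>" | "q \<le> m" "m \<le> q + \<delta>" "p + \<delta> < m"
    by linarith
  then show ?thesis
  proof cases
    case 1
    then have "W = V" by (auto simp: V_def W_def)
    then have "row_bound n \<delta> (insert q A) m = row_bound n \<delta> A m"
      by (simp add: row_bound_def V_def W_def)
    with 1 pq show ?thesis by auto
  next
    case 2
    have W: "W = insert q V" using 2 pq by (auto simp: V_def W_def)
    have pV: "p \<in> V" using 2 pq pA by (auto simp: V_def)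
    have "Max V = p" by (rule Max_eqI) (use pV pA fin in \<open>auto simp: V_def\<close>)
    moreover have "Max W = q"
      unfolding W by (rule Max_eqI) (use less fin in \<open>auto simp: V_def less_imp_le\<close>)
    moreover have "Min W = Min V"
    proof -
      have "Min V \<le> p" using pV fin by simp
      with pq have "Min V < q" by simp
      then show ?thesis unfolding W using fin pV by (subst Min_insert) auto
    qed
    ultimately have "row_bound n \<delta> (insert q A) m = row_bound n \<delta> A m - (int q - int p)"
      using pV W unfolding row_bound_def Let_def V_def[symmetric] W_def[symmetric] by auto
    with 2 show ?thesis by auto
  next
    case 3
    then have "V = {}" using pA by (force simp: V_def)
    moreover have "W = {q}" using 3 \<open>V = {}\<close> by (auto simp: V_def W_def)
    ultimately have "row_bound n \<delta> (insert q A) m = int n" "row_bound n \<delta> A m = 0"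
      unfolding row_bound_def Let_def V_def[symmetric] W_def[symmetric] by auto
    with 3 show ?thesis by auto
  qed
qed

text \<open>For a gap \<open>g = q - p\<close> with \<open>g \<le> \<delta>\<close>,
  \<open>\<delta> + 1 - g\<close> rows lose \<open>g\<close> each and \<open>g\<close> rows gain
  \<open>n\<close> each, while \<open>\<delta> + 1 - g \<le> n\<close>. For a larger gap no row
  loses.\<close>

lemma gap_gain:
  fixes n \<delta> p q :: nat
  assumes "\<delta> < n" and "p < q"
  shows "int (card {q..p + \<delta>}) * (int q - int p)
    \<le> int (card {max q (Suc (p + \<delta>))..q + \<delta>}) * int n"
proof (cases "q \<le> p + \<delta>")
  case True
  then have "card {max q (Suc (p + \<delta>))..q + \<delta>} = q - p" by (simp add: max_def)
  moreover have "int (card {q..p + \<delta>}) \<le> int n" using assms by simp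
  ultimately show ?thesis using assms
    by (simp add: of_nat_diff mult.commute mult_left_mono del: card_atLeastAtMost)
next
  case False
  then show ?thesis by simp
qed

lemma sum_row_bound:
  assumes "\<delta> < n" and "finite A" and "A \<noteq> {}" and "\<forall>k\<in>A. k + \<delta> \<le> M"
  shows "int (n * (\<delta> + 1)) \<le> (\<Sum>m\<le>M. row_bound n \<delta> A m)"
  using assms(2-)
proof (induction A rule: finite_linorder_max_induct)
  case empty
  then show ?case by simp
next
  case (insert q A)
  \<comment> \<open>The condition \<open>u \<le> M\<close> ensures that the summation range cuts off
    no row of the interval.\<close>
  have restr: "(\<Sum>m\<le>M. if m \<in> {l..u} then c else 0) = int (card {l..u}) * c"
    if "u \<le> M" for l u and c :: int
  proof -
    have "(\<Sum>m\<le>M. if m \<in> {l..u} then c else 0) = (\<Sum>m\<in>{..M} \<inter> {l..u}. c)"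
      by (rule sum.inter_restrict[symmetric]) simp
    also have "{..M} \<inter> {l..u} = {l..u}" using that by auto
    finally show ?thesis by simp
  qed
  show ?case
  proof (cases "A = {}")
    case True
    \<comment> \<open>A single exponent is visible in exactly \<open>\<delta> + 1\<close> rows, each
      worth \<open>n\<close>.\<close>
    have "row_bound n \<delta> {q} m = (if m \<in> {q..q + \<delta>} then int n else 0)" for m
      by (simp add: row_bound_singleton)
    then show ?thesis
      using True restr[of "q + \<delta>" q "int n"] insert.prems by (simp add: algebra_simps)
  next
    case False
    define p where "p = Max A"
    have pq: "p < q" using insert False by (simp add: p_def)
    have "int (n * (\<delta> + 1)) \<le> (\<Sum>m\<le>M. row_bound n \<delta> A m)"
      using insert False by auto
    also have "\<dots> \<le> (\<Sum>m\<le>M. row_bound n \<delta> A m) +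
        (int (card {max q (Suc (p + \<delta>))..q + \<delta>}) * int n
         - int (card {q..p + \<delta>}) * (int q - int p))"
      using gap_gain[OF assms(1) pq] by simp
    also have "\<dots> = (\<Sum>m\<le>M. row_bound n \<delta> A m +
      ((if m \<in> {max q (Suc (p + \<delta>))..q + \<delta>} then int n else 0)
       - (if m \<in> {q..p + \<delta>} then int q - int p else 0)))"
    proof -
      have "q + \<delta> \<le> M" "p + \<delta> \<le> M" using insert.prems pq by auto
      then show ?thesis by (simp only: sum.distrib sum_subtractf restr)
    qed
    also have "\<dots> \<le> (\<Sum>m\<le>M. row_bound n \<delta> (insert q A) m)"
      by (intro sum_mono row_bound_insert_max insert.hyps False p_def)
    finally show ?thesis .
  qed
qed

section \<open>Weights of codewords\<close>

text \<open>Dividing by \<open>x^l\<close> keeps the non-zero roots and leaves a polynomial of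
  degree at most \<open>u - l\<close>.\<close>

lemma card_nonzero_roots_le:
  fixes p :: "'a::idom poly"
  assumes "p \<noteq> 0" and supp: "\<And>j. Polynomial.coeff p j \<noteq> 0 \<Longrightarrow> l \<le> j \<and> j \<le> u"
  shows "card {x. x \<noteq> 0 \<and> poly p x = 0} \<le> u - l"
proof -
  define r where "r = poly_shift l p"
  have p: "p = Polynomial.monom 1 l * r"
    by (rule poly_eqI)
       (use supp in \<open>auto simp: coeff_monom_mult r_def coeff_poly_shift not_le[symmetric]\<close>)
  then have "r \<noteq> 0" using assms(1) by auto
  have "degree r \<le> u - l"
    by (rule degree_le) (use supp in \<open>fastforce simp: r_def coeff_poly_shift\<close>)
  have "{x. x \<noteq> 0 \<and> poly p x = 0} \<subseteq> {x. poly r x = 0}"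
    by (auto simp: p poly_monom)
  then have "card {x. x \<noteq> 0 \<and> poly p x = 0} \<le> card {x. poly r x = 0}"
    using poly_roots_finite[OF \<open>r \<noteq> 0\<close>] by (rule card_mono[rotated])
  also have "\<dots> \<le> degree r" by (rule card_poly_roots_bound) fact
  finally show ?thesis using \<open>degree r \<le> u - l\<close> by simp
qed

section \<open>Taylor expansion of \<open>s_poly\<close> at \<open>b\<close>\<close>

lemma coeff_pcompose_s_poly:
  "Polynomial.coeff (s_poly \<delta> v \<circ>\<^sub>p [:b, c:]) k = s_hasse \<delta> v k b * c ^ k"
proof -
  have monom: "Polynomial.monom x i \<circ>\<^sub>p q = Polynomial.smult x (q ^ i)" for x :: 'a and i q
    by (induction i) (simp_all add: monom_0 monom_Suc pcompose_pCons)
  \<comment> \<open>The binomial theorem produces the Hasse derivatives without dividing by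
    factorials, so the expansion is valid in every characteristic.\<close>
  have coeff: "Polynomial.coeff ([:b, c:] ^ i) k
      = (if k \<le> i then of_nat (i choose k) * c ^ k * b ^ (i - k) else 0)" for i
  proof (cases "k \<le> i")
    case False
    then have "degree ([:b, c:] ^ i) < k"
      using degree_power_le[of "[:b, c:]" i] by (simp split: if_splits)
    with False show ?thesis by (simp add: coeff_eq_0)
  qed (simp add: coeff_linear_poly_power)
  have "Polynomial.coeff (s_poly \<delta> v \<circ>\<^sub>p [:b, c:]) k
      = (\<Sum>i=0..\<delta>. if k \<le> i then of_nat (i choose k) * v $ i * b ^ (i - k) * c ^ k else 0)"
    unfolding s_poly_def pcompose_sum coeff_sum monom
    by (intro sum.cong) (auto simp: coeff algebra_simps)
  also have "\<dots> = (\<Sum>i=k..\<delta>. of_nat (i choose k) * v $ i * b ^ (i - k) * c ^ k)"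
    by (rule sum.mono_neutral_cong_right) auto
  finally show ?thesis by (simp add: s_hasse_def sum_distrib_right)
qed

lemma s_hasse_eq_0_above: "\<delta> < k \<Longrightarrow> s_hasse \<delta> v k b = 0"
  by (simp add: s_hasse_def)

text \<open>Substituting \<open>t + b\<close> for \<open>t\<close> is injective on polynomials, so a
  polynomial whose Taylor coefficients at \<open>b\<close> all vanish is zero.\<close>

lemma ex_s_hasse_neq_0:
  assumes "v \<in> carrier_vec (Suc \<delta>)" and "v \<noteq> 0\<^sub>v (Suc \<delta>)"
  shows "\<exists>k\<le>\<delta>. s_hasse \<delta> v k b \<noteq> 0"
proof (rule ccontr)
  assume *: "\<not> ?thesis"
  have "Polynomial.coeff (s_poly \<delta> v \<circ>\<^sub>p [:b, 1:]) k = 0" for k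
    using * s_hasse_eq_0_above[of \<delta> k v b]
    by (cases "k \<le> \<delta>") (auto simp: coeff_pcompose_s_poly)
  then have "s_poly \<delta> v \<circ>\<^sub>p [:b, 1:] = 0" by (intro poly_eqI) simp
  then have "s_poly \<delta> v = 0" by (rule pcompose_eq_0) simp
  then have "Polynomial.coeff (s_poly \<delta> v) i = 0" for i by simp
  moreover have "Polynomial.coeff (s_poly \<delta> v) i = v $ i" if "i \<le> \<delta>" for i
    using that by (simp add: s_poly_def coeff_sum)
  ultimately have "v $ i = 0" if "i \<le> \<delta>" for i using that by simp
  then have "v = 0\<^sub>v (Suc \<delta>)" using assms(1) by (intro eq_vecI) auto
  with assms(2) show False by simp
qed

lemma ex_vec_s_hasse_eq_1:
  "\<exists>v \<in> carrier_vec (Suc \<delta>). \<forall>k\<le>\<delta>. s_hasse \<delta> v k b = 1"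
proof -
  define e :: "'a poly" where "e = (\<Sum>j\<le>\<delta>. Polynomial.monom 1 j)"
  \<comment> \<open>This is the sum of the \<open>(t - b)^j\<close>. The shift keeps the degree, so
    the coefficients fit into a vector of length \<open>\<delta> + 1\<close>.\<close>
  define p where "p = e \<circ>\<^sub>p [:- b, 1:]"
  define v where "v = vec (Suc \<delta>) (Polynomial.coeff p)"
  have "degree e \<le> \<delta>"
    unfolding e_def by (intro degree_sum_le) (auto intro: order.trans[OF degree_monom_le])
  then have deg: "degree p \<le> \<delta>" unfolding p_def by (simp add: degree_pcompose)
  have "s_poly \<delta> v = (\<Sum>i\<le>\<delta>. Polynomial.monom (Polynomial.coeff p i) i)"
    unfolding s_poly_def v_def atLeast0AtMost by (intro sum.cong) auto
  also have "\<dots> = p" by (rule poly_as_sum_of_monoms'[OF deg])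
  finally have "s_poly \<delta> v \<circ>\<^sub>p [:b, 1:] = e \<circ>\<^sub>p ([:- b, 1:] \<circ>\<^sub>p [:b, 1:])"
    by (simp only: p_def pcompose_assoc)
  also have "\<dots> = e" by (simp add: pcompose_pCons)
  finally have "s_poly \<delta> v \<circ>\<^sub>p [:b, 1:] = e" .
  then have "s_hasse \<delta> v k b = Polynomial.coeff e k" for k
    using coeff_pcompose_s_poly[of \<delta> v b 1 k] by simp
  then have "s_hasse \<delta> v k b = 1" if "k \<le> \<delta>" for k
    using that by (simp add: e_def coeff_sum)
  moreover have "v \<in> carrier_vec (Suc \<delta>)" by (simp add: v_def)
  ultimately show ?thesis by blast
qed

lemma coeff_goppa_generator:
  "i < n \<Longrightarrow> Polynomial.coeff (goppa_generator n \<delta> a b v $ i) k = s_hasse \<delta> v k b * a i ^ k"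
  by (simp add: goppa_generator_def coeff_pcompose_s_poly)

text \<open>As every \<open>a i ^ k\<close> is non-zero, all \<open>n\<close> entries have the
  support of the sequence of Taylor coefficients.\<close>

lemma weight_goppa_generator:
  assumes "\<forall>i<n. a i \<noteq> 0"
  shows "weight (goppa_generator n \<delta> a b v) = n * card {k. s_hasse \<delta> v k b \<noteq> 0}"
proof -
  have "weight (goppa_generator n \<delta> a b v) = (\<Sum>i<n. card {k. s_hasse \<delta> v k b \<noteq> 0})"
    unfolding weight_def
    by (intro sum.cong) (use assms in \<open>auto simp: goppa_generator_def coeff_pcompose_s_poly\<close>)
  then show ?thesis by simp
qed

lemma goppa_generator_neq_0:
  assumes "0 < n" and "\<forall>i<n. a i \<noteq> 0" and "v \<in> carrier_vec (Suc \<delta>)" and "v \<noteq> 0\<^sub>v (Suc \<delta>)"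
  shows "goppa_generator n \<delta> a b v \<noteq> 0\<^sub>v n"
proof
  assume eq: "goppa_generator n \<delta> a b v = 0\<^sub>v n"
  obtain k where "s_hasse \<delta> v k b \<noteq> 0" using ex_s_hasse_neq_0[OF assms(3,4)] by blast
  then show False
    using coeff_goppa_generator[OF assms(1), of \<delta> a b v k] assms(1,2) by (simp add: eq)
qed

section \<open>Counting the coefficients of a codeword by powers of \<open>z\<close>\<close>

lemma weight_eq_sum_rows:
  assumes "\<And>i. i < dim_vec w \<Longrightarrow> degree (w $ i) \<le> M"
  shows "weight w = (\<Sum>m\<le>M. card {i. i < dim_vec w \<and> Polynomial.coeff (w $ i) m \<noteq> 0})"
proof -
  have "card {k. Polynomial.coeff (w $ i) k \<noteq> 0}
      = (\<Sum>m\<le>M. if Polynomial.coeff (w $ i) m \<noteq> 0 then 1 else 0)" if "i < dim_vec w" for i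
  proof -
    have "{k. Polynomial.coeff (w $ i) k \<noteq> 0} = {m \<in> {..M}. Polynomial.coeff (w $ i) m \<noteq> 0}"
      using order.trans[OF le_degree assms[OF that]] by blast
    then show ?thesis by (simp add: sum.If_cases Int_def)
  qed
  then have "weight w = (\<Sum>i<dim_vec w. \<Sum>m\<le>M. if Polynomial.coeff (w $ i) m \<noteq> 0 then 1 else 0)"
    unfolding weight_def by (intro sum.cong) auto
  also have "\<dots> = (\<Sum>m\<le>M. \<Sum>i<dim_vec w. if Polynomial.coeff (w $ i) m \<noteq> 0 then 1 else 0)"
    by (rule sum.swap)
  also have "\<dots> = (\<Sum>m\<le>M. card {i. i < dim_vec w \<and> Polynomial.coeff (w $ i) m \<noteq> 0})"
    by (intro sum.cong) (auto simp: sum.If_cases Int_def)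
  finally show ?thesis .
qed

text \<open>Row \<open>m\<close> lists the values of one polynomial \<open>q\<close> at the
  \<open>a i\<close>. Its zeros among these distinct non-zero points are at most the spread of its
  exponents, which is the spread of the window.\<close>

lemma row_bound_le_card:
  fixes a :: "nat \<Rightarrow> 'a::field" and \<alpha> :: "'a poly"
  assumes "\<forall>i<n. a i \<noteq> 0" and "inj_on a {..<n}"
    and hasse: "\<forall>j\<le>\<delta>. s_hasse \<delta> v j b \<noteq> 0"
  shows "row_bound n \<delta> {k. Polynomial.coeff \<alpha> k \<noteq> 0} m
    \<le> int (card {i. i < n \<and> Polynomial.coeff (\<alpha> * goppa_generator n \<delta> a b v $ i) m \<noteq> 0})"
proof -
  define W where "W = {k. Polynomial.coeff \<alpha> k \<noteq> 0} \<inter> {k. k \<le> m \<and> m \<le> k + \<delta>}"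
  \<comment> \<open>Terms with \<open>j > \<delta>\<close> vanish together with
    \<open>s_hasse\<close>, so only coefficients of \<open>\<alpha>\<close> in the window
    contribute.\<close>
  define q where "q = (\<Sum>j\<le>m. Polynomial.monom (Polynomial.coeff \<alpha> (m - j) * s_hasse \<delta> v j b) j)"
  have fin: "finite W" by (rule finite_subset[of _ "{..m}"]) (auto simp: W_def)
  have row: "Polynomial.coeff (\<alpha> * goppa_generator n \<delta> a b v $ i) m = poly q (a i)" if "i < n" for i
    unfolding mult.commute[of \<alpha>] coeff_mult q_def poly_sum poly_monom
    by (intro sum.cong) (simp_all add: coeff_goppa_generator[OF that])
  \<comment> \<open>Non-zero Taylor coefficients make the support of \<open>q\<close> the exact
    mirror image of the window: \<open>Max W\<close> yields the lowest exponent,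
    \<open>Min W\<close> the highest.\<close>
  have coeff_q: "Polynomial.coeff q j \<noteq> 0 \<longleftrightarrow> j \<le> m \<and> m - j \<in> W" for j
    using hasse s_hasse_eq_0_above[of \<delta> j v b]
    by (cases "j \<le> \<delta>") (auto simp: q_def coeff_sum W_def)
  show ?thesis
  proof (cases "W = {}")
    case True
    then show ?thesis by (simp add: row_bound_def W_def[symmetric])
  next
    case False
    then obtain k where "k \<in> W" by blast
    then have "Polynomial.coeff q (m - k) \<noteq> 0"
      unfolding coeff_q by (auto simp: W_def)
    then have "q \<noteq> 0" by auto
    have supp: "m - Max W \<le> j \<and> j \<le> m - Min W" if "Polynomial.coeff q j \<noteq> 0" for j
    proof -
      have "j \<le> m" "m - j \<in> W" using that coeff_q by auto
      then have "m - j \<le> Max W" "Min W \<le> m - j" using fin by auto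
      with \<open>j \<le> m\<close> show ?thesis by linarith
    qed
    have "Max W \<le> m" using Max_in[OF fin False] by (simp add: W_def)
    moreover have "Min W \<le> Max W" using fin False by simp
    ultimately have span: "int ((m - Min W) - (m - Max W)) = int (Max W) - int (Min W)" by simp
    have "card {i. i < n \<and> poly q (a i) = 0} = card (a ` {i. i < n \<and> poly q (a i) = 0})"
      by (rule card_image[symmetric]) (rule inj_on_subset[OF assms(2)], auto)
    also have "\<dots> \<le> card {x. x \<noteq> 0 \<and> poly q x = 0}"
      by (rule card_mono)
         (use assms(1) poly_roots_finite[OF \<open>q \<noteq> 0\<close>] in \<open>auto intro: finite_subset[rotated]\<close>)
    also have "\<dots> \<le> (m - Min W) - (m - Max W)"
      by (rule card_nonzero_roots_le[OF \<open>q \<noteq> 0\<close> supp])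
    finally have zeros: "int (card {i. i < n \<and> poly q (a i) = 0}) \<le> int (Max W) - int (Min W)"
      unfolding span[symmetric] by (simp only: of_nat_le_iff)
    have "{i. i < n \<and> poly q (a i) \<noteq> 0} = {..<n} - {i. i < n \<and> poly q (a i) = 0}" by auto
    then have "card {i. i < n \<and> poly q (a i) \<noteq> 0} = n - card {i. i < n \<and> poly q (a i) = 0}"
      by (simp only:) (subst card_Diff_subset, auto)
    moreover have "card {i. i < n \<and> Polynomial.coeff (\<alpha> * goppa_generator n \<delta> a b v $ i) m \<noteq> 0}
      = card {i. i < n \<and> poly q (a i) \<noteq> 0}"
      by (rule arg_cong[where f = card]) (auto simp: row)
    moreover have "row_bound n \<delta> {k. Polynomial.coeff \<alpha> k \<noteq> 0} m = int n - (int (Max W) - int (Min W))"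
      using False by (simp add: row_bound_def W_def[symmetric])
    ultimately show ?thesis using zeros by linarith
  qed
qed

lemma weight_goppa_codeword_ge:
  assumes "\<delta> < n" and "\<forall>i<n. a i \<noteq> 0" and "inj_on a {..<n}"
    and hasse: "\<forall>j\<le>\<delta>. s_hasse \<delta> v j b \<noteq> 0" and "\<alpha> \<noteq> 0"
  shows "n * (\<delta> + 1) \<le> weight (\<alpha> \<cdot>\<^sub>v goppa_generator n \<delta> a b v)"
proof -
  define A where "A = {k. Polynomial.coeff \<alpha> k \<noteq> 0}"
  \<comment> \<open>Large enough both to bound the degrees of the entries and to include every row
    that sees an element of the support of \<open>\<alpha>\<close>.\<close>
  define M where "M = degree \<alpha> + \<delta>"
  let ?w = "\<alpha> \<cdot>\<^sub>v goppa_generator n \<delta> a b v"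
  have dim: "dim_vec ?w = n" by (simp add: goppa_generator_def)
  have w: "?w $ i = \<alpha> * goppa_generator n \<delta> a b v $ i" if "i < n" for i
    using that by (simp add: goppa_generator_def)
  have A: "finite A" "A \<noteq> {}" "\<forall>k\<in>A. k + \<delta> \<le> M"
    using \<open>\<alpha> \<noteq> 0\<close> le_degree[of \<alpha>]
    by (auto simp: A_def M_def poly_eq_iff intro!: finite_subset[of _ "{..degree \<alpha>}"])
  have "degree (goppa_generator n \<delta> a b v $ i) \<le> \<delta>" if "i < n" for i
    by (rule degree_le) (simp add: coeff_goppa_generator[OF that] s_hasse_eq_0_above)
  then have deg: "degree (?w $ i) \<le> M" if "i < n" for i
    unfolding w[OF that] M_def using that
    by (intro order.trans[OF degree_mult_le] add_left_mono)
  have weight: "weight ?w = (\<Sum>m\<le>M. card {i. i < n \<and> Polynomial.coeff (?w $ i) m \<noteq> 0})"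
    using weight_eq_sum_rows[of ?w M, unfolded dim] deg by blast
  have "int (n * (\<delta> + 1)) \<le> (\<Sum>m\<le>M. row_bound n \<delta> A m)"
    by (rule sum_row_bound[OF assms(1) A])
  also have "\<dots> \<le> (\<Sum>m\<le>M. int (card {i. i < n \<and> Polynomial.coeff (?w $ i) m \<noteq> 0}))"
  proof (rule sum_mono)
    fix m
    have "{i. i < n \<and> Polynomial.coeff (?w $ i) m \<noteq> 0}
      = {i. i < n \<and> Polynomial.coeff (\<alpha> * goppa_generator n \<delta> a b v $ i) m \<noteq> 0}"
      by (auto simp: w simp del: index_smult_vec)
    then show "row_bound n \<delta> A m \<le> int (card {i. i < n \<and> Polynomial.coeff (?w $ i) m \<noteq> 0})"
      unfolding A_def using row_bound_le_card[OF assms(2,3) hasse] by simp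
  qed
  also have "\<dots> = int (weight ?w)" by (simp only: weight of_nat_sum)
  finally show ?thesis by (simp only: of_nat_le_iff)
qed

text \<open>The generator decides: one vanishing Taylor coefficient puts its own weight below the
  bound. If none vanishes, it attains the bound and no non-zero codeword is lighter.\<close>

lemma is_MDS_goppa_iff:
  assumes "\<delta> < n" and "\<forall>i<n. a i \<noteq> 0" and "inj_on a {..<n}"
    and "v \<in> carrier_vec (Suc \<delta>)" and "v \<noteq> 0\<^sub>v (Suc \<delta>)"
  shows "is_MDS n \<delta> (conv_code (goppa_generator n \<delta> a b v)) \<longleftrightarrow> (\<forall>j\<le>\<delta>. s_hasse \<delta> v j b \<noteq> 0)"
proof -
  let ?G = "goppa_generator n \<delta> a b v"
  define D where "D = weight ` (conv_code ?G - {0\<^sub>v n})"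
  have "?G = 1 \<cdot>\<^sub>v ?G" by simp
  then have "?G \<in> conv_code ?G" unfolding conv_code_def by (rule range_eqI)
  \<comment> \<open>The generator is a non-zero codeword, so the set of weights is non-empty and its
    \<open>Inf\<close> is a true minimum.\<close>
  then have G: "weight ?G \<in> D"
    using goppa_generator_neq_0[OF _ assms(2,4,5), of b] assms(1) by (auto simp: D_def)
  have sub: "{k. s_hasse \<delta> v k b \<noteq> 0} \<subseteq> {..\<delta>}"
    using s_hasse_eq_0_above[of \<delta> _ v b] by (auto simp: not_less[symmetric])
  show ?thesis
  proof
    assume MDS: "is_MDS n \<delta> (conv_code ?G)"
    show "\<forall>j\<le>\<delta>. s_hasse \<delta> v j b \<noteq> 0"
    proof (rule ccontr)
      assume "\<not> ?thesis"
      with sub have "{k. s_hasse \<delta> v k b \<noteq> 0} \<subset> {..\<delta>}" by auto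
      then have "card {k. s_hasse \<delta> v k b \<noteq> 0} < \<delta> + 1"
        using psubset_card_mono[of "{..\<delta>}"] by simp
      then have "weight ?G < n * (\<delta> + 1)"
        unfolding weight_goppa_generator[OF assms(2)] using assms(1) by (intro mult_strict_left_mono) simp_all
      moreover have "Inf D \<le> weight ?G" by (rule cInf_lower[OF G]) simp
      ultimately show False using MDS by (simp add: is_MDS_def free_distance_def D_def)
    qed
  next
    assume hasse: "\<forall>j\<le>\<delta>. s_hasse \<delta> v j b \<noteq> 0"
    with sub have "{k. s_hasse \<delta> v k b \<noteq> 0} = {..\<delta>}" by auto
    then have "n * (\<delta> + 1) \<in> D" using G by (simp add: weight_goppa_generator[OF assms(2)])
    moreover have "n * (\<delta> + 1) \<le> d" if "d \<in> D" for d
    proof -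
      from that obtain \<alpha> where d: "d = weight (\<alpha> \<cdot>\<^sub>v ?G)" and "\<alpha> \<cdot>\<^sub>v ?G \<noteq> 0\<^sub>v n"
        by (auto simp: D_def conv_code_def)
      then have "\<alpha> \<noteq> 0" by (auto simp: goppa_generator_def)
      then show ?thesis unfolding d by (rule weight_goppa_codeword_ge[OF assms(1-3) hasse])
    qed
    ultimately have "Inf D = n * (\<delta> + 1)" by (rule cInf_eq_minimum)
    then show "is_MDS n \<delta> (conv_code ?G)" by (simp add: is_MDS_def free_distance_def D_def)
  qed
qed

section \<open>Complements of hyperplanes are Zariski open\<close>

definition monom_eval :: "(nat \<Rightarrow>\<^sub>0 nat) \<Rightarrow> 'a::comm_semiring_1 vec \<Rightarrow> 'a" where
  "monom_eval m v = (\<Prod>i\<in>Poly_Mapping.keys m. v $ i ^ Poly_Mapping.lookup m i)"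

text \<open>Absent variables contribute factors 1, so monomials with different supports can be
  compared over a common index set.\<close>

lemma monom_eval_superset:
  assumes "finite I" and "Poly_Mapping.keys m \<subseteq> I"
  shows "monom_eval m v = (\<Prod>i\<in>I. v $ i ^ Poly_Mapping.lookup m i)"
  unfolding monom_eval_def
  by (rule prod.mono_neutral_left[OF assms]) (simp add: in_keys_iff)

lemma monom_eval_add: "monom_eval (m + m') v = monom_eval m v * monom_eval m' v"
proof -
  define I where "I = Poly_Mapping.keys m \<union> Poly_Mapping.keys m'"
  have "finite I" "Poly_Mapping.keys m \<subseteq> I" "Poly_Mapping.keys m' \<subseteq> I"
    "Poly_Mapping.keys (m + m') \<subseteq> I"
    using Poly_Mapping.keys_add[of m m'] by (auto simp: I_def)
  then show ?thesis
    by (simp add: monom_eval_superset[of I] lookup_add power_add prod.distrib)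
qed

lemma multipoly_eval_superset:
  assumes "finite M" and "Poly_Mapping.keys f \<subseteq> M"
  shows "multipoly_eval f v = (\<Sum>m\<in>M. Poly_Mapping.lookup f m * monom_eval m v)"
  unfolding multipoly_eval_def monom_eval_def
  by (rule sum.mono_neutral_left[OF assms]) (simp add: in_keys_iff)

lemma multipoly_eval_zero [simp]: "multipoly_eval 0 v = 0"
  by (simp add: multipoly_eval_def)

lemma multipoly_eval_single:
  "multipoly_eval (Poly_Mapping.single m c) v = c * monom_eval m v"
  by (subst multipoly_eval_superset[of "{m}"]) auto

lemma multipoly_eval_one [simp]: "multipoly_eval 1 v = 1"
  unfolding single_one[symmetric] multipoly_eval_single by (simp add: monom_eval_def)

lemma multipoly_eval_add: "multipoly_eval (f + g) v = multipoly_eval f v + multipoly_eval g v"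
proof -
  define M where "M = Poly_Mapping.keys f \<union> Poly_Mapping.keys g"
  have "finite M" "Poly_Mapping.keys f \<subseteq> M" "Poly_Mapping.keys g \<subseteq> M"
    "Poly_Mapping.keys (f + g) \<subseteq> M"
    using Poly_Mapping.keys_add[of f g] by (auto simp: M_def)
  then show ?thesis
    by (simp add: multipoly_eval_superset[of M] lookup_add distrib_right sum.distrib)
qed

lemma multipoly_eval_sum: "multipoly_eval (\<Sum>i\<in>I. f i) v = (\<Sum>i\<in>I. multipoly_eval (f i) v)"
  by (induction I rule: infinite_finite_induct) (simp_all add: multipoly_eval_add)

lemma multipoly_eq_sum_single:
  "f = (\<Sum>m\<in>Poly_Mapping.keys f. Poly_Mapping.single m (Poly_Mapping.lookup f m))"
  by (rule poly_mapping_eqI) (simp add: lookup_sum lookup_single when_def in_keys_iff)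

text \<open>Both factors are expanded into single terms, where multiplication merely adds exponents
  and \<open>monom_eval_add\<close> applies.\<close>

lemma multipoly_eval_mult: "multipoly_eval (f * g) v = multipoly_eval f v * multipoly_eval g v"
proof -
  have "multipoly_eval (f * g) v =
    multipoly_eval ((\<Sum>m\<in>Poly_Mapping.keys f. Poly_Mapping.single m (Poly_Mapping.lookup f m)) *
      (\<Sum>m\<in>Poly_Mapping.keys g. Poly_Mapping.single m (Poly_Mapping.lookup g m))) v"
    by (simp flip: multipoly_eq_sum_single)
  also have "\<dots> = (\<Sum>m\<in>Poly_Mapping.keys f. Poly_Mapping.lookup f m * monom_eval m v) *
      (\<Sum>m\<in>Poly_Mapping.keys g. Poly_Mapping.lookup g m * monom_eval m v)"
    unfolding sum_product
    by (simp add: multipoly_eval_sum mult_single multipoly_eval_single monom_eval_add mult_ac)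
  finally show ?thesis
    by (simp add: multipoly_eval_superset[of "Poly_Mapping.keys f" f]
        multipoly_eval_superset[of "Poly_Mapping.keys g" g])
qed

lemma multipoly_eval_prod: "multipoly_eval (\<Prod>i\<in>I. f i) v = (\<Prod>i\<in>I. multipoly_eval (f i) v)"
  by (induction I rule: infinite_finite_induct) (simp_all add: multipoly_eval_mult)

section \<open>Homogeneity of products and linear forms\<close>

lemma homogeneous_one: "homogeneous_of_degree \<delta> 0 1"
  by (simp add: homogeneous_of_degree_def)

lemma homogeneous_mult:
  assumes "homogeneous_of_degree \<delta> d f" and "homogeneous_of_degree \<delta> e g"
  shows "homogeneous_of_degree \<delta> (d + e) (f * g)"
  unfolding homogeneous_of_degree_def
proof
  fix m assume "m \<in> Poly_Mapping.keys (f * g)"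
  then obtain k l where m: "m = k + l"
    and k: "k \<in> Poly_Mapping.keys f" and l: "l \<in> Poly_Mapping.keys g"
    using Poly_Mapping.keys_mult[of f g] by blast
  \<comment> \<open>Summing exponents over the fixed range \<open>{0..\<delta>}\<close> instead of
    the support makes the degree additive.\<close>
  have deg: "(\<Sum>i\<in>Poly_Mapping.keys q. Poly_Mapping.lookup q i) = (\<Sum>i=0..\<delta>. Poly_Mapping.lookup q i)"
    if "Poly_Mapping.keys q \<subseteq> {0..\<delta>}" for q :: "nat \<Rightarrow>\<^sub>0 nat"
    by (rule sum.mono_neutral_left) (use that in \<open>auto simp: in_keys_iff\<close>)
  have kl: "Poly_Mapping.keys k \<subseteq> {0..\<delta>}" "Poly_Mapping.keys l \<subseteq> {0..\<delta>}"
    using assms k l by (auto simp: homogeneous_of_degree_def)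
  then have sub: "Poly_Mapping.keys m \<subseteq> {0..\<delta>}"
    using Poly_Mapping.keys_add[of k l] unfolding m by blast
  have "(\<Sum>i=0..\<delta>. Poly_Mapping.lookup k i) = d" "(\<Sum>i=0..\<delta>. Poly_Mapping.lookup l i) = e"
    using assms k l by (auto simp: homogeneous_of_degree_def simp flip: deg[OF kl(1)] deg[OF kl(2)])
  then show "Poly_Mapping.keys m \<subseteq> {0..\<delta>} \<and>
      (\<Sum>i\<in>Poly_Mapping.keys m. Poly_Mapping.lookup m i) = d + e"
    using sub unfolding deg[OF sub] by (simp add: m lookup_add sum.distrib)
qed

lemma homogeneous_prod:
  assumes "finite I" and "\<And>i. i \<in> I \<Longrightarrow> homogeneous_of_degree \<delta> (d i) (f i)"
  shows "homogeneous_of_degree \<delta> (\<Sum>i\<in>I. d i) (\<Prod>i\<in>I. f i)"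
  using assms by induction (auto intro: homogeneous_one homogeneous_mult)

definition linear_form :: "nat \<Rightarrow> (nat \<Rightarrow> 'a::comm_semiring_1) \<Rightarrow> 'a multipoly" where
  "linear_form \<delta> c = (\<Sum>r=0..\<delta>. Poly_Mapping.single (Poly_Mapping.single r 1) (c r))"

lemma homogeneous_linear_form: "homogeneous_of_degree \<delta> 1 (linear_form \<delta> c)"
proof -
  have "Poly_Mapping.keys (linear_form \<delta> c) \<subseteq> (\<lambda>r. Poly_Mapping.single r 1) ` {0..\<delta>}"
    unfolding linear_form_def
    by (rule order.trans[OF keys_sum]) (auto split: if_splits)
  then show ?thesis by (auto simp: homogeneous_of_degree_def)
qed

lemma multipoly_eval_linear_form: "multipoly_eval (linear_form \<delta> c) v = (\<Sum>r=0..\<delta>. c r * v $ r)"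
  by (simp add: linear_form_def multipoly_eval_sum multipoly_eval_single monom_eval_def)

text \<open>The complement is a finite union of hyperplanes, which over a field is the zero set of
  the product of their linear forms.\<close>

lemma zariski_open_hyperplane_complement:
  assumes "finite J"
  shows "zariski_open \<delta> {P \<in> proj_space \<delta>. \<forall>v\<in>P. \<forall>j\<in>J. (\<Sum>r=0..\<delta>. c j r * v $ r) \<noteq> 0}"
    (is "zariski_open \<delta> ?U")
proof -
  define f where "f = (\<Prod>j\<in>J. linear_form \<delta> (c j))"
  have "homogeneous_of_degree \<delta> (\<Sum>j\<in>J. 1) f"
    unfolding f_def by (intro homogeneous_prod homogeneous_linear_form assms)
  moreover have eval: "multipoly_eval f v = 0 \<longleftrightarrow> (\<exists>j\<in>J. (\<Sum>r=0..\<delta>. c j r * v $ r) = 0)" for v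
    using assms by (simp add: f_def multipoly_eval_prod multipoly_eval_linear_form)
  have "proj_space \<delta> - ?U = proj_zero_set \<delta> {f}"
  proof (intro subset_antisym subsetI)
    fix P assume "P \<in> proj_space \<delta> - ?U"
    then obtain v j where P: "P \<in> proj_space \<delta>" and v: "v \<in> P"
      and j: "j \<in> J" "(\<Sum>r=0..\<delta>. c j r * v $ r) = 0" by blast
    \<comment> \<open>So far one form vanishes at one representative; scaling carries this zero to
      the whole class.\<close>
    have "(\<Sum>r=0..\<delta>. c j r * w $ r) = 0" if "w \<in> P" for w
    proof -
      obtain x where w: "w = x \<cdot>\<^sub>v v" using proj_space_cases(3)[OF P v] \<open>w \<in> P\<close> by blast
      have "dim_vec v = Suc \<delta>" using proj_space_cases(1)[OF P v] by simp
      then have "(\<Sum>r=0..\<delta>. c j r * w $ r) = x * (\<Sum>r=0..\<delta>. c j r * v $ r)"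
        by (simp add: w sum_distrib_left mult_ac)
      with j show ?thesis by simp
    qed
    with P j(1) show "P \<in> proj_zero_set \<delta> {f}"
      unfolding proj_zero_set_def by (auto simp: eval)
  next
    fix P assume "P \<in> proj_zero_set \<delta> {f}"
    then have P: "P \<in> proj_space \<delta>" "\<forall>v\<in>P. multipoly_eval f v = 0"
      by (auto simp: proj_zero_set_def)
    \<comment> \<open>A class has a representative, so the vanishing of \<open>f\<close> on
      \<open>P\<close> is not vacuous and violates the condition defining \<open>?U\<close>.\<close>
    then show "P \<in> proj_space \<delta> - ?U"
      using proj_space_nonempty_class[OF P(1)] by (auto simp: eval)
  qed
  ultimately show ?thesis
    unfolding zariski_open_def zariski_closed_def by blast
qed

section \<open>The MDS locus\<close>

text \<open>Extending the sum by zero coefficients exhibits the Hasse derivative at \<open>b\<close>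
  as a linear form in the homogeneous coordinates.\<close>

lemma s_hasse_eq_linear_form:
  "s_hasse \<delta> v j b = (\<Sum>r=0..\<delta>. (if j \<le> r then of_nat (r choose j) * b ^ (r - j) else 0) * v $ r)"
  unfolding s_hasse_def by (rule sum.mono_neutral_cong_left) auto

theorem theorem4p2:
  fixes n \<delta> :: nat and a :: "nat \<Rightarrow> 'a::{field,finite}" and b :: 'a
  assumes "\<delta> < n"
    and "\<forall>i<n. a i \<noteq> 0"
    and "inj_on a {..<n}"
  shows "zariski_open \<delta> {P \<in> proj_space \<delta>. is_MDS n \<delta> (goppa_code n \<delta> a b P)} \<and>
         {P \<in> proj_space \<delta>. is_MDS n \<delta> (goppa_code n \<delta> a b P)} \<noteq> {} \<and>
         {P \<in> proj_space \<delta>. is_MDS n \<delta> (goppa_code n \<delta> a b P)} =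
         {P \<in> proj_space \<delta>. \<forall>v\<in>P. \<forall>j\<le>\<delta>. s_hasse \<delta> v j b \<noteq> 0}"
proof -
  let ?U = "{P \<in> proj_space \<delta>. \<forall>v\<in>P. \<forall>j\<le>\<delta>. s_hasse \<delta> v j b \<noteq> 0}"
  have MDS: "is_MDS n \<delta> (goppa_code n \<delta> a b P) \<longleftrightarrow> (\<forall>v\<in>P. \<forall>j\<le>\<delta>. s_hasse \<delta> v j b \<noteq> 0)"
    if P: "P \<in> proj_space \<delta>" for P
  proof -
    \<comment> \<open>The left side does not depend on \<open>v\<close>, so the condition holds for
      one representative exactly when it holds for all.\<close>
    have "is_MDS n \<delta> (goppa_code n \<delta> a b P) \<longleftrightarrow> (\<forall>j\<le>\<delta>. s_hasse \<delta> v j b \<noteq> 0)" if "v \<in> P" for v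
      unfolding goppa_code_class[OF P that]
      by (rule is_MDS_goppa_iff[OF assms proj_space_cases(1,2)[OF P that]])
    with proj_space_nonempty_class[OF P] show ?thesis by blast
  qed
  have eq: "{P \<in> proj_space \<delta>. is_MDS n \<delta> (goppa_code n \<delta> a b P)} = ?U"
    using MDS by blast
  have "zariski_open \<delta> ?U"
    using zariski_open_hyperplane_complement[of "{..\<delta>}" \<delta>
      "\<lambda>j r. if j \<le> r then of_nat (r choose j) * b ^ (r - j) else 0"]
    unfolding s_hasse_eq_linear_form[symmetric] by (simp add: Ball_def)
  moreover have "?U \<noteq> {}"
  proof -
    obtain v :: "'a vec" where v: "v \<in> carrier_vec (Suc \<delta>)" "\<forall>k\<le>\<delta>. s_hasse \<delta> v k b = 1"
      using ex_vec_s_hasse_eq_1 by blast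
    have "v \<noteq> 0\<^sub>v (Suc \<delta>)"
    proof
      assume "v = 0\<^sub>v (Suc \<delta>)"
      then have "s_hasse \<delta> v 0 b = 0" by (auto simp: s_hasse_def intro!: sum.neutral)
      with v(2) show False by simp
    qed
    define P where "P = scaling_rel \<delta> `` {v}"
    have P: "P \<in> proj_space \<delta>"
      unfolding P_def proj_space_def by (rule quotientI) (use v \<open>v \<noteq> _\<close> in simp)
    have "1 \<cdot>\<^sub>v v \<in> P"
      unfolding P_def scaling_rel_def using v \<open>v \<noteq> _\<close> one_neq_zero by blast
    then have "v \<in> P" by simp
    have "s_hasse \<delta> w j b \<noteq> 0" if "w \<in> P" "j \<le> \<delta>" for w j
      using s_hasse_class[OF P \<open>v \<in> P\<close> \<open>w \<in> P\<close>, of j b] v(2) \<open>j \<le> \<delta>\<close> by simp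
    with P show ?thesis by blast
  qed
  ultimately show ?thesis unfolding eq by blast
qed

end
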